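(* Let $\alpha,\beta,c,d>0$ and $l\ge 0$ be real constants with $l<\alpha<\frac{\beta(l+1)+l}{\beta+2}$. Then there is a nonempty open set $U\subset\mathbb{R}^2$ of initial data such that for every $(u_0,u_1)\in U$ the solution $u$ on $\mathbb{R}^+$ of $$\big(|u'|^{l}u'\big)'+c|u'|^{\alpha}u'+d|u|^{\beta}u=0,\qquad u(0)=u_0,\quad u'(0)=u_1,$$ is a slow solution, i.e. satisfies $$\limsup_{t\to\infty}t^{\frac{(\alpha+1)(\beta+2)}{\beta-\alpha}}E(t)>0,\qquad\text{where } E(t)=\frac{l+1}{l+2}|u'(t)|^{l+2}+\frac{d}{\beta+2}|u(t)|^{\beta+2}.$$
   Context: $\mathbb{R}^+=[0,+\infty)$. A solution on $\mathbb{R}^+$ is a function $u\in\mathcal{C}^1(\mathbb{R}^+)$ with $|u'|^lu'\in\mathcal{C}^1(\mathbb{R}^+)$ which satisfies the equation at every point. Under the stated hypotheses one has $l<\alpha<\beta$, and the initial value problem has exactly one solution for each $(u_0,u_1)\in\mathbb{R}^2$. *)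

theory Defs
  imports "HOL-Analysis.Analysis"
begin

text \<open>
  \<open>f'\<close> is the derivative of \<open>f\<close> on \<open>[0, \<infinity>)\<close> (one-sided at \<open>0\<close>) and is continuous there.
  The values of \<open>f'\<close> on \<open>[0, \<infinity>)\<close> are determined by \<open>f\<close>; values at negative times are irrelevant.
\<close>
definition C1_half_line :: "(real \<Rightarrow> real) \<Rightarrow> (real \<Rightarrow> real) \<Rightarrow> bool" where
  "C1_half_line f f' \<longleftrightarrow>
     (\<forall>t\<in>{0..}. (f has_real_derivative f' t) (at t within {0..})) \<and> continuous_on {0..} f'"

text \<open>
  In the equation below, \<open>w\<close> is the derivative of \<open>|u'|^l u'\<close>. For \<open>l = 0\<close> the convention
  \<open>0 powr 0 = 0\<close> is harmless, since \<open>|x| powr 0 * x = x\<close> also at \<open>x = 0\<close>.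
\<close>
definition solution_half_line ::
  "real \<Rightarrow> real \<Rightarrow> real \<Rightarrow> real \<Rightarrow> real \<Rightarrow> (real \<Rightarrow> real) \<Rightarrow> (real \<Rightarrow> real) \<Rightarrow> bool" where
  "solution_half_line \<alpha> \<beta> c d l u u' \<longleftrightarrow>
     C1_half_line u u' \<and>
     (\<exists>w. C1_half_line (\<lambda>t. \<bar>u' t\<bar> powr l * u' t) w \<and>
       (\<forall>t\<in>{0..}. w t + c * (\<bar>u' t\<bar> powr \<alpha> * u' t) + d * (\<bar>u t\<bar> powr \<beta> * u t) = 0))"

definition energy ::
  "real \<Rightarrow> real \<Rightarrow> real \<Rightarrow> (real \<Rightarrow> real) \<Rightarrow> (real \<Rightarrow> real) \<Rightarrow> real \<Rightarrow> real" where
  "energy \<beta> d l u u' t =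
     (l + 1) / (l + 2) * \<bar>u' t\<bar> powr (l + 2) + d / (\<beta> + 2) * \<bar>u t\<bar> powr (\<beta> + 2)"

text \<open>The upper limit is taken in the extended reals, so that \<open>\<infinity>\<close> is an admissible value.\<close>
definition slow ::
  "real \<Rightarrow> real \<Rightarrow> real \<Rightarrow> real \<Rightarrow> (real \<Rightarrow> real) \<Rightarrow> (real \<Rightarrow> real) \<Rightarrow> bool" where
  "slow \<alpha> \<beta> d l u u' \<longleftrightarrow>
     Limsup at_top
       (\<lambda>t. ereal (t powr ((\<alpha> + 1) * (\<beta> + 2) / (\<beta> - \<alpha>)) * energy \<beta> d l u u' t)) > 0"

end

theory Submission
  imports Defs
begin

text \<open>
  Put \<open>p = (\<beta> + 1) / (\<alpha> + 1) > 1\<close> and choose \<open>K\<close> with \<open>c K\<^sup>\<alpha>\<^sup>+\<^sup>1 = 2 d\<close>. The upper bound on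
  \<open>\<alpha>\<close> says exactly that \<open>p (l + 2) - 1 > \<beta> + 1\<close>; hence on the curve \<open>u' = - K u\<^sup>p\<close> with \<open>u\<close> small
  the excess of the damping over the restoring force dominates the inertial term, so the region
  \<open>0 < u < \<epsilon>\<close>, \<open>- K u\<^sup>p < u' < 0\<close> is positively invariant. Integrating \<open>u' \<ge> - K u\<^sup>p\<close> gives
  \<open>u\<^sup>1\<^sup>-\<^sup>p \<le> A + B t\<close>, which is the slow decay rate.
\<close>

section \<open>First-exit arguments on the half line\<close>

lemma at_within_half_line:
  fixes t :: real
  assumes "t > 0"
  shows "at t within {0..} = at t"
  using assms by (intro at_within_interior) auto

lemma half_line_left_limit_ge:
  fixes f :: "real \<Rightarrow> real"
  assumes "continuous_on {0..} f" and "t > 0" and "\<And>s. 0 \<le> s \<Longrightarrow> s < t \<Longrightarrow> m \<le> f s"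
  shows "m \<le> f t"
proof -
  have "(f \<longlongrightarrow> f t) (at t)"
    using assms(1,2) at_within_half_line[OF assms(2)] by (auto simp: continuous_on_def dest!: bspec[where x = t])
  then have "(f \<longlongrightarrow> f t) (at_left t)"
    by (rule tendsto_within_subset) auto
  moreover have "eventually (\<lambda>s. m \<le> f s) (at_left t)"
    using eventually_at_left_real[OF \<open>t > 0\<close>] by eventually_elim (use assms(3) in auto)
  ultimately show ?thesis
    by (intro tendsto_lowerbound[of f "f t" "at_left t"]) auto
qed

text \<open>By continuity the times with \<open>H s \<le> 0\<close> form a closed set. If it were
  nonempty, its infimum would be a first bad time, positive because \<open>H 0 > 0\<close>, and
  \<open>step\<close> excludes exactly such a time.\<close>

lemma half_line_first_exit:
  fixes H :: "real \<Rightarrow> real"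
  assumes cont: "continuous_on {0..} H" and "H 0 > 0"
    and step: "\<And>t. t > 0 \<Longrightarrow> (\<And>s. 0 \<le> s \<Longrightarrow> s < t \<Longrightarrow> H s > 0) \<Longrightarrow> H t > 0"
    and "t \<ge> 0"
  shows "H t > 0"
proof (rule ccontr)
  assume "\<not> H t > 0"
  define S where "S = {s \<in> {0..}. H s \<in> {..0}}"
  have "closed S"
    unfolding S_def
    using continuous_closed_preimage[OF cont closed_atLeast closed_atMost[of 0]]
    by (simp add: vimage_def Int_def)
  have ne: "S \<noteq> {}"
    using \<open>\<not> H t > 0\<close> \<open>t \<ge> 0\<close> by (auto simp: S_def)
  have bdd: "bdd_below S"
    by (auto simp: S_def bdd_below_def)
  have "Inf S \<in> S"
    using closed_contains_Inf ne bdd \<open>closed S\<close> by blast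
  then have "Inf S \<ge> 0" "H (Inf S) \<le> 0"
    by (auto simp: S_def)
  then have "Inf S > 0"
    using \<open>H 0 > 0\<close> by (cases "Inf S = 0") auto
  moreover have "H s > 0" if "0 \<le> s" "s < Inf S" for s
    using cInf_lower[OF _ bdd, of s] that by (force simp: S_def)
  ultimately show False
    using step \<open>H (Inf S) \<le> 0\<close> by force
qed

text \<open>A positive derivative would force \<open>f\<close> to be negative just to the left of
  its zero.\<close>

lemma deriv_nonpos_at_first_zero:
  fixes f :: "real \<Rightarrow> real"
  assumes "(f has_real_derivative D) (at t)" and "t > 0" and "f t = 0"
    and "\<And>s. 0 \<le> s \<Longrightarrow> s < t \<Longrightarrow> f s > 0"
  shows "D \<le> 0"
proof (rule ccontr)
  assume "\<not> D \<le> 0"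
  then obtain e where e: "e > 0" "\<And>h. h > 0 \<Longrightarrow> h < e \<Longrightarrow> f (t - h) < f t"
    using DERIV_pos_inc_left[OF assms(1)] by force
  define h where "h = min (e / 2) t"
  have "h > 0" "h < e" "h \<le> t"
    using e(1) assms(2) by (auto simp: h_def)
  then show False
    using e(2)[of h] assms(3) assms(4)[of "t - h"] by auto
qed

section \<open>Integration of the power differential inequality\<close>

text \<open>The derivative of \<open>u powr (1 - p)\<close> is
  \<open>(p - 1) * u powr (- p) * (- u')\<close>, at most \<open>(p - 1) * K\<close>, so this power
  grows at most linearly; inverting the decreasing power gives the bound. It serves both to keep
  \<open>u\<close> away from zero in finite time and to obtain the decay rate.\<close>

lemma power_inequality_lower_bound:
  fixes u u' :: "real \<Rightarrow> real"
  assumes deriv: "\<And>s. 0 \<le> s \<Longrightarrow> s \<le> t \<Longrightarrow> (u has_real_derivative u' s) (at s within {0..})"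
    and pos: "\<And>s. 0 \<le> s \<Longrightarrow> s \<le> t \<Longrightarrow> u s > 0"
    and ineq: "\<And>s. 0 \<le> s \<Longrightarrow> s \<le> t \<Longrightarrow> - u' s \<le> K * u s powr p"
    and "p > 1" and "t \<ge> 0"
  shows "(u 0 powr (1 - p) + (p - 1) * K * t) powr (- 1 / (p - 1)) \<le> u t"
proof -
  define g where "g s = u s powr (1 - p) - (p - 1) * K * s" for s
  \<comment> \<open>Monotonicity is derived from the open interval, since at 0 only a one-sided
    derivative is available.\<close>
  have "g t \<le> g 0"
  proof (rule DERIV_nonpos_imp_decreasing_open[OF \<open>t \<ge> 0\<close>])
    fix s assume s: "0 < s" "s < t"
    have us: "u s > 0"
      using pos s by auto
    have "(u has_real_derivative u' s) (at s)"
      using deriv[of s] s at_within_half_line[of s] by auto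
    from DERIV_diff[OF DERIV_fun_powr[OF this us, of "1 - p"] DERIV_cmult[OF DERIV_ident, of "(p - 1) * K"]]
    have "(g has_real_derivative (1 - p) * u s powr (1 - p - 1) * u' s - (p - 1) * K) (at s)"
      unfolding g_def by simp
    moreover have "(1 - p) * u s powr (1 - p - 1) * u' s - (p - 1) * K \<le> 0"
    proof -
      have "u s powr (- p) * - u' s \<le> u s powr (- p) * (K * u s powr p)"
        using ineq s by (intro mult_left_mono) auto
      also have "\<dots> = K"
        using us by (simp add: powr_minus)
      finally have "(p - 1) * (u s powr (- p) * - u' s) \<le> (p - 1) * K"
        using \<open>p > 1\<close> by (intro mult_left_mono) auto
      then show ?thesis
        by (simp add: algebra_simps)
    qed
    ultimately show "\<exists>y. (g has_real_derivative y) (at s) \<and> y \<le> 0"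
      by blast
  next
    have "continuous_on {0..t} u"
      using deriv by (intro DERIV_continuous_on[where D = u'])
        (rule DERIV_subset[where s = "{0..}"], auto)
    then show "continuous_on {0..t} g"
      unfolding g_def using pos by (intro continuous_intros) force+
  qed
  then have *: "u t powr (1 - p) \<le> u 0 powr (1 - p) + (p - 1) * K * t"
    by (simp add: g_def)
  have ut: "u t > 0"
    using pos \<open>t \<ge> 0\<close> by auto
  have "(u 0 powr (1 - p) + (p - 1) * K * t) powr (- 1 / (p - 1)) \<le> (u t powr (1 - p)) powr (- 1 / (p - 1))"
    using * ut \<open>p > 1\<close> by (intro powr_mono2') auto
  also have "\<dots> = u t"
  proof -
    have "(1 - p) * (- 1 / (p - 1)) = 1"
      using \<open>p > 1\<close> by (simp add: field_simps)
    then show ?thesis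
      unfolding powr_powr using ut by simp
  qed
  finally show ?thesis .
qed

section \<open>Positive invariance of the region under the curve\<close>

text \<open>For \<open>v \<le> 0\<close> the signed power is \<open>- ((- v) powr (l + 1))\<close>.
  This transfers a bound on \<open>u'\<close> to \<open>\<bar>u'\<bar> powr l * u'\<close>, the
  quantity whose derivative the equation controls.\<close>

lemma signed_powr_less:
  fixes v x l :: real
  assumes "v \<le> 0" and "- v < x" and "l \<ge> 0"
  shows "0 < x powr (l + 1) + \<bar>v\<bar> powr l * v"
proof -
  have "\<bar>v\<bar> powr l * v = - ((- v) powr (l + 1))"
    using assms(1) by (cases "v = 0") (auto simp: powr_add)
  moreover have "(- v) powr (l + 1) < x powr (l + 1)"
    using assms by (intro powr_less_mono2) auto
  ultimately show ?thesis
    by simp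
qed

text \<open>The four inequalities are recovered one by one at a putative first exit time. The
  hypothesis on \<epsilon> compares, on the curve, the inertial term of the barrier with the surplus
  \<open>d * x powr (\<beta> + 1)\<close> of damping over restoring force.\<close>

lemma invariant_region:
  fixes \<alpha> \<beta> c d l K p \<epsilon> :: real
  assumes "c > 0" and "d > 0" and "l \<ge> 0" and "\<alpha> > 0"
    and "K > 0" and K: "c * K powr (\<alpha> + 1) = 2 * d"
    and "p > 1" and p: "p * (\<alpha> + 1) = \<beta> + 1"
    and \<epsilon>: "\<And>x. 0 < x \<Longrightarrow> x < \<epsilon> \<Longrightarrow>
      K powr (l + 2) * p * (l + 1) * x powr (p * (l + 2) - 1) < d * x powr (\<beta> + 1)"
    and sol: "solution_half_line \<alpha> \<beta> c d l u u'"
    and init: "0 < u 0" "u 0 < \<epsilon>" "u' 0 < 0" "- u' 0 < K * u 0 powr p"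
    and "t \<ge> 0"
  shows "0 < u t \<and> u t < \<epsilon> \<and> u' t < 0 \<and> - u' t < K * u t powr p"
proof -
  obtain w where du: "\<And>t. t \<ge> 0 \<Longrightarrow> (u has_real_derivative u' t) (at t within {0..})"
    and cu': "continuous_on {0..} u'"
    and dw: "\<And>t. t \<ge> 0 \<Longrightarrow> ((\<lambda>t. \<bar>u' t\<bar> powr l * u' t) has_real_derivative w t) (at t within {0..})"
    and eq: "\<And>t. t \<ge> 0 \<Longrightarrow> w t + c * (\<bar>u' t\<bar> powr \<alpha> * u' t) + d * (\<bar>u t\<bar> powr \<beta> * u t) = 0"
    using sol unfolding solution_half_line_def C1_half_line_def by auto
  have cu: "continuous_on {0..} u"
    using du by (intro DERIV_continuous_on) auto
  \<comment> \<open>The minimum of the four gaps encodes the region by one continuous function. The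
    absolute value keeps the base of the power nonnegative and is harmless where
    \<open>u t > 0\<close>.\<close>
  define H where
    "H t = min (min (u t) (\<epsilon> - u t)) (min (- u' t) (K * \<bar>u t\<bar> powr p + u' t))" for t
  have H_iff: "H t > 0 \<longleftrightarrow> 0 < u t \<and> u t < \<epsilon> \<and> u' t < 0 \<and> - u' t < K * u t powr p" for t
    by (cases "u t > 0") (auto simp: H_def)
  have "H t > 0"
  proof (rule half_line_first_exit[OF _ _ _ \<open>t \<ge> 0\<close>])
    show "continuous_on {0..} H"
      unfolding H_def using cu cu' \<open>p > 1\<close> by (intro continuous_intros continuous_on_powr') auto
    show "H 0 > 0"
      using init by (simp add: H_iff)
  next
    fix t :: real assume "t > 0" and "\<And>s. 0 \<le> s \<Longrightarrow> s < t \<Longrightarrow> H s > 0"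
    then have before: "0 < u s" "u s < \<epsilon>" "u' s < 0" "- u' s < K * u s powr p"
      if "0 \<le> s" "s < t" for s
      using that by (auto simp: H_iff)
    have du_t: "(u has_real_derivative u' t) (at t)"
      and dw_t: "((\<lambda>t. \<bar>u' t\<bar> powr l * u' t) has_real_derivative w t) (at t)"
      using du[of t] dw[of t] \<open>t > 0\<close> by (simp_all add: at_within_half_line)
    \<comment> \<open>Continuity alone would only give \<open>u t \<ge> 0\<close>. The integrated
      bound holds at each \<open>s < t\<close> and decreases in time, so its value at
      \<open>t\<close> is a positive lower bound on all of \<open>[0, t)\<close> that survives the
      limit.\<close>
    have "u t > 0"
    proof -
      define A where "A = u 0 powr (1 - p)"
      have "A > 0"
        using init by (simp add: A_def)
      have "(A + (p - 1) * K * t) powr (- 1 / (p - 1)) \<le> u t"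
      proof (rule half_line_left_limit_ge[OF cu \<open>t > 0\<close>])
        fix s assume s: "0 \<le> s" "s < t"
        have "(A + (p - 1) * K * t) powr (- 1 / (p - 1)) \<le> (A + (p - 1) * K * s) powr (- 1 / (p - 1))"
          using \<open>p > 1\<close> \<open>K > 0\<close> \<open>A > 0\<close> s
          by (intro powr_mono2') (auto intro!: add_pos_nonneg)
        also have "\<dots> \<le> u s"
          unfolding A_def
          by (rule power_inequality_lower_bound[where u' = u'])
            (use s before du \<open>p > 1\<close> in \<open>auto intro!: less_imp_le\<close>)
        finally show "(A + (p - 1) * K * t) powr (- 1 / (p - 1)) \<le> u s" .
      qed
      moreover have "A + (p - 1) * K * t > 0"
        using \<open>p > 1\<close> \<open>K > 0\<close> \<open>A > 0\<close> \<open>t > 0\<close> by (simp add: add_pos_nonneg)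
      ultimately show ?thesis
        using powr_gt_zero[of "A + (p - 1) * K * t" "- 1 / (p - 1)"] by linarith
    qed
    moreover have "u t < \<epsilon>"
    proof -
      have "u t \<le> u 0"
      proof (rule DERIV_nonpos_imp_decreasing_open[of 0 t u])
        show "\<exists>y. (u has_real_derivative y) (at s) \<and> y \<le> 0" if "0 < s" "s < t" for s
          using du[of s] that before[of s] by (intro exI[of _ "u' s"]) (auto simp: at_within_half_line)
        show "continuous_on {0..t} u"
          using cu by (rule continuous_on_subset) auto
      qed (use \<open>t > 0\<close> in auto)
      then show ?thesis
        using init by simp
    qed
    \<comment> \<open>Where \<open>u'\<close> vanishes, the restoring force alone gives
      \<open>w t < 0\<close>; but a first zero of the previously positive
      \<open>- (\<bar>u'\<bar> powr l * u')\<close> requires \<open>- w t \<le> 0\<close>. The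
      signed power replaces \<open>u'\<close>, which may fail to be differentiable at its
      zeros.\<close>
    moreover have "u' t < 0"
    proof (rule ccontr)
      assume "\<not> u' t < 0"
      moreover have "0 \<le> - u' t"
        by (rule half_line_left_limit_ge[OF continuous_on_minus[OF cu'] \<open>t > 0\<close>])
          (use before(3) in \<open>auto intro: less_imp_le\<close>)
      ultimately have "u' t = 0"
        by simp
      then have "w t = - (d * (u t powr \<beta> * u t))"
        using eq[of t] \<open>t > 0\<close> \<open>u t > 0\<close> by simp
      then have "w t < 0"
        using \<open>d > 0\<close> \<open>u t > 0\<close> by simp
      moreover have "- w t \<le> 0"
      proof (rule deriv_nonpos_at_first_zero[OF DERIV_minus[OF dw_t] \<open>t > 0\<close>])
        show "0 < - (\<bar>u' s\<bar> powr l * u' s)" if "0 \<le> s" "s < t" for s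
          using before(3)[OF that] by (simp add: mult_pos_neg)
      qed (simp add: \<open>u' t = 0\<close>)
      ultimately show False
        by simp
    qed
    moreover have "- u' t < K * u t powr p"
    proof (rule ccontr)
      assume "\<not> - u' t < K * u t powr p"
      moreover have "0 \<le> K * \<bar>u t\<bar> powr p + u' t"
      proof (rule half_line_left_limit_ge[where f = "\<lambda>t. K * \<bar>u t\<bar> powr p + u' t", OF _ \<open>t > 0\<close>])
        show "continuous_on {0..} (\<lambda>t. K * \<bar>u t\<bar> powr p + u' t)"
          using cu cu' \<open>p > 1\<close> by (intro continuous_intros continuous_on_powr') auto
        show "0 \<le> K * \<bar>u s\<bar> powr p + u' s" if "0 \<le> s" "s < t" for s
          using before[OF that] by simp
      qed
      ultimately have v: "u' t = - (K * u t powr p)"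
        using \<open>u t > 0\<close> by simp
      \<comment> \<open>The gap to the curve, measured after raising both sides to the power
        \<open>l + 1\<close>: it is positive before \<open>t\<close> and vanishes at
        \<open>t\<close>, so its derivative \<open>D\<close> there cannot be positive.\<close>
      define G where "G s = K powr (l + 1) * u s powr (p * (l + 1)) + \<bar>u' s\<bar> powr l * u' s" for s
      have G_eq: "G s = (K * u s powr p) powr (l + 1) + \<bar>u' s\<bar> powr l * u' s" for s
        using \<open>K > 0\<close> by (simp add: G_def powr_mult powr_powr)
      define D where
        "D = K powr (l + 1) * (p * (l + 1) * u t powr (p * (l + 1) - 1) * u' t) + w t"
      have "((\<lambda>s. u s powr (p * (l + 1))) has_real_derivative
          p * (l + 1) * u t powr (p * (l + 1) - 1) * u' t) (at t)"
        using DERIV_fun_powr[OF du_t \<open>u t > 0\<close>, of "p * (l + 1)"] by simp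
      from DERIV_add[OF DERIV_cmult[OF this, of "K powr (l + 1)"] dw_t]
      have "(G has_real_derivative D) (at t)"
        unfolding G_def D_def .
      moreover have "G t = 0"
        using v \<open>K > 0\<close> \<open>u t > 0\<close> by (simp add: G_eq powr_add)
      moreover have "G s > 0" if "0 \<le> s" "s < t" for s
        unfolding G_eq using before[OF that] \<open>l \<ge> 0\<close> by (intro signed_powr_less) auto
      ultimately have "D \<le> 0"
        using deriv_nonpos_at_first_zero \<open>t > 0\<close> by blast
      \<comment> \<open>On the curve the choice of \<open>K\<close> makes the damping term twice the
        restoring term in size, with opposite sign, which leaves
        \<open>w t = d * u t powr (\<beta> + 1)\<close>.\<close>
      have "\<bar>u' t\<bar> powr \<alpha> * u' t = - ((K * u t powr p) powr (\<alpha> + 1))"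
        using v \<open>K > 0\<close> \<open>u t > 0\<close> by (simp add: powr_add)
      also have "\<dots> = - (K powr (\<alpha> + 1) * u t powr (\<beta> + 1))"
        using \<open>K > 0\<close> p by (simp add: powr_mult powr_powr)
      finally have "w t = c * K powr (\<alpha> + 1) * u t powr (\<beta> + 1) - d * (u t powr \<beta> * u t)"
        using eq[of t] \<open>t > 0\<close> \<open>u t > 0\<close> by simp
      also have "\<dots> = d * u t powr (\<beta> + 1)"
        using K \<open>u t > 0\<close> by (simp add: powr_add)
      finally have w: "w t = d * u t powr (\<beta> + 1)" .
      \<comment> \<open>Inserting \<open>u' t = - (K * u t powr p)\<close> turns the derivative of
        the barrier into minus the left side of the \<epsilon> condition, so
        \<open>D > 0\<close>.\<close>
      have "K powr (l + 1) * K = K powr (l + 2)"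
        using \<open>K > 0\<close> powr_add[of K "l + 1" 1] by (simp add: add.commute)
      moreover have "u t powr (p * (l + 1) - 1) * u t powr p = u t powr (p * (l + 2) - 1)"
        by (simp add: powr_add[symmetric] algebra_simps)
      moreover have "D = - ((K powr (l + 1) * K) * p * (l + 1) *
          (u t powr (p * (l + 1) - 1) * u t powr p)) + w t"
        unfolding D_def v by (simp add: algebra_simps)
      ultimately have "D = - (K powr (l + 2) * p * (l + 1) * u t powr (p * (l + 2) - 1)) + w t"
        by simp
      then have "D > 0"
        using \<epsilon>[OF \<open>u t > 0\<close> \<open>u t < \<epsilon>\<close>] w by simp
      then show False
        using \<open>D \<le> 0\<close> by simp
    qed
    ultimately show "H t > 0"
      by (simp add: H_iff)
  qed
  then show ?thesis
    by (simp add: H_iff)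
qed

section \<open>From the differential inequality to slow decay\<close>

text \<open>The bound \<open>u t \<ge> (A + B * t) powr (- 1 / (p - 1))\<close> makes the potential
  energy decay no faster than \<open>t powr (- \<gamma>)\<close> up to a constant, because
  \<open>\<gamma> = (\<beta> + 2) / (p - 1)\<close> is the exponent in \<open>slow\<close>.\<close>

lemma slow_if_power_inequality:
  fixes \<alpha> \<beta> d l K p :: real
  assumes "d > 0" and "\<alpha> > 0" and "\<alpha> < \<beta>" and "l \<ge> 0"
    and "K > 0" and p: "p * (\<alpha> + 1) = \<beta> + 1"
    and deriv: "\<And>t. t \<ge> 0 \<Longrightarrow> (u has_real_derivative u' t) (at t within {0..})"
    and pos: "\<And>t. t \<ge> 0 \<Longrightarrow> u t > 0"
    and ineq: "\<And>t. t \<ge> 0 \<Longrightarrow> - u' t \<le> K * u t powr p"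
  shows "slow \<alpha> \<beta> d l u u'"
proof -
  have p_eq: "p - 1 = (\<beta> - \<alpha>) / (\<alpha> + 1)"
    using p \<open>\<alpha> > 0\<close> by (simp add: field_simps)
  then have "p - 1 > 0"
    using assms(2,3) by simp
  define \<gamma> where "\<gamma> = (\<alpha> + 1) * (\<beta> + 2) / (\<beta> - \<alpha>)"
  have \<gamma>: "\<gamma> = (\<beta> + 2) / (p - 1)"
    unfolding p_eq \<gamma>_def by simp
  have "\<gamma> > 0"
    using assms(2,3) by (simp add: \<gamma>_def)
  define A where "A = u 0 powr (1 - p)"
  define B where "B = (p - 1) * K"
  have "A > 0" "B > 0"
    using pos[of 0] \<open>p - 1 > 0\<close> \<open>K > 0\<close> by (auto simp: A_def B_def)
  \<comment> \<open>For \<open>t \<ge> 1\<close> one has \<open>A + B * t \<le> (A + B) * t\<close>,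
    hence \<open>t / (A + B * t) \<ge> 1 / (A + B)\<close>; \<open>m\<close> is the resulting lower
    bound for the weighted potential energy.\<close>
  define m where "m = d / (\<beta> + 2) * (1 / (A + B)) powr \<gamma>"
  have "m > 0"
    using assms(1,2,3) \<open>A > 0\<close> \<open>B > 0\<close> by (simp add: m_def)
  have "m \<le> t powr \<gamma> * energy \<beta> d l u u' t" if "t \<ge> 1" for t
  proof -
    have "A + B * t > 0"
      using \<open>A > 0\<close> \<open>B > 0\<close> that by (simp add: add_pos_nonneg)
    have "A + B * t \<le> (A + B) * t"
      using mult_left_mono[OF that, of A] \<open>A > 0\<close> by (simp add: algebra_simps)
    then have "1 / (A + B) \<le> t / (A + B * t)"
      using \<open>A > 0\<close> \<open>B > 0\<close> \<open>A + B * t > 0\<close> by (simp add: field_simps)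
    then have "(1 / (A + B)) powr \<gamma> \<le> (t / (A + B * t)) powr \<gamma>"
      using \<open>\<gamma> > 0\<close> \<open>A > 0\<close> \<open>B > 0\<close> by (intro powr_mono2) auto
    also have "\<dots> = t powr \<gamma> * ((A + B * t) powr (- 1 / (p - 1))) powr (\<beta> + 2)"
      using that \<open>A + B * t > 0\<close> by (simp add: powr_divide powr_powr powr_minus_divide \<gamma>)
    also have "\<dots> \<le> t powr \<gamma> * u t powr (\<beta> + 2)"
    proof -
      have "(A + B * t) powr (- 1 / (p - 1)) \<le> u t"
        unfolding A_def B_def
        by (rule power_inequality_lower_bound[where u' = u'])
          (use deriv pos ineq \<open>p - 1 > 0\<close> that in auto)
      then show ?thesis
        using assms(2,3) by (intro mult_left_mono powr_mono2) auto
    qed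
    finally have "m \<le> d / (\<beta> + 2) * (t powr \<gamma> * u t powr (\<beta> + 2))"
      unfolding m_def using assms(1,2,3) by (intro mult_left_mono) auto
    also have "\<dots> = t powr \<gamma> * (d / (\<beta> + 2) * u t powr (\<beta> + 2))"
      by simp
    also have "\<dots> \<le> t powr \<gamma> * energy \<beta> d l u u' t"
      unfolding energy_def using pos[of t] that \<open>l \<ge> 0\<close> by (intro mult_left_mono) auto
    finally show ?thesis .
  qed
  then have "ereal m \<le> Limsup at_top (\<lambda>t. ereal (t powr \<gamma> * energy \<beta> d l u u' t))"
    by (intro le_Limsup) (auto intro!: eventually_mono[OF eventually_ge_at_top[of "1::real"]])
  moreover have "0 < ereal m"
    using \<open>m > 0\<close> by simp
  ultimately show ?thesis
    unfolding slow_def \<gamma>_def[symmetric] by (rule less_le_trans[rotated])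
qed

section \<open>Choice of the constants and of the open set of data\<close>

theorem theorem5p6:
  fixes \<alpha> \<beta> c d l :: real
  assumes "\<alpha> > 0" and "\<beta> > 0" and "c > 0" and "d > 0" and "l \<ge> 0"
    and "l < \<alpha>" and "\<alpha> < (\<beta> * (l + 1) + l) / (\<beta> + 2)"
  shows "\<exists>U :: (real \<times> real) set. open U \<and> U \<noteq> {} \<and>
    (\<forall>(u0, u1) \<in> U. \<forall>u u'. solution_half_line \<alpha> \<beta> c d l u u' \<and> u 0 = u0 \<and> u' 0 = u1 \<longrightarrow>
       slow \<alpha> \<beta> d l u u')"
proof -
  have upper: "\<alpha> * (\<beta> + 2) < \<beta> * (l + 1) + l"
    using assms(2,7) by (simp add: field_simps)
  \<comment> \<open>Replacing \<open>\<beta> * l + l\<close> in \<open>upper\<close> by the larger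
    \<open>\<beta> * \<alpha> + \<alpha>\<close> leaves \<open>\<alpha> < \<beta>\<close>, hence
    \<open>p > 1\<close>.\<close>
  have "\<beta> * l \<le> \<beta> * \<alpha>"
    using assms(2,6) by (intro mult_left_mono) auto
  then have "\<alpha> < \<beta>"
    using upper \<open>l < \<alpha>\<close> by (simp add: algebra_simps)
  define p where "p = (\<beta> + 1) / (\<alpha> + 1)"
  have p: "p * (\<alpha> + 1) = \<beta> + 1" and "p > 1"
    using \<open>\<alpha> > 0\<close> \<open>\<alpha> < \<beta>\<close> by (auto simp: p_def)
  define q where "q = p * (l + 2) - 1 - (\<beta> + 1)"
  have "q * (\<alpha> + 1) = p * (\<alpha> + 1) * (l + 2) - (\<beta> + 2) * (\<alpha> + 1)"
    by (simp add: q_def algebra_simps)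
  also have "\<dots> = \<beta> * (l + 1) + l - \<alpha> * (\<beta> + 2)"
    unfolding p by (simp add: algebra_simps)
  finally have "q * (\<alpha> + 1) > 0"
    using upper by simp
  then have "q > 0"
    using \<open>\<alpha> > 0\<close> by (simp add: zero_less_mult_iff)
  define K where "K = (2 * d / c) powr (1 / (\<alpha> + 1))"
  have "K > 0" and K: "c * K powr (\<alpha> + 1) = 2 * d"
    using assms(1,3,4) by (auto simp: K_def powr_powr)
  define L where "L = K powr (l + 2) * p * (l + 1)"
  have "L > 0"
    using \<open>K > 0\<close> \<open>p > 1\<close> \<open>l \<ge> 0\<close> by (simp add: L_def)
  \<comment> \<open>The solution of \<open>L * \<epsilon> powr q = d\<close>. As
    \<open>q > 0\<close>, smaller \<open>x\<close> satisfy \<open>L * x powr q < d\<close>, and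
    multiplying by \<open>x powr (\<beta> + 1)\<close> gives the condition required for
    invariance.\<close>
  define \<epsilon> where "\<epsilon> = (d / L) powr (1 / q)"
  have "\<epsilon> > 0"
    using \<open>d > 0\<close> \<open>L > 0\<close> by (simp add: \<epsilon>_def)
  have \<epsilon>: "K powr (l + 2) * p * (l + 1) * x powr (p * (l + 2) - 1) < d * x powr (\<beta> + 1)"
    if "0 < x" "x < \<epsilon>" for x
  proof -
    have "x powr q < \<epsilon> powr q"
      using that \<open>q > 0\<close> by (intro powr_less_mono2) auto
    also have "\<dots> = d / L"
      using \<open>d > 0\<close> \<open>L > 0\<close> \<open>q > 0\<close> by (simp add: \<epsilon>_def powr_powr)
    finally have "L * x powr q < d"
      using \<open>L > 0\<close> by (simp add: field_simps)
    then have "L * x powr q * x powr (\<beta> + 1) < d * x powr (\<beta> + 1)"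
      using \<open>0 < x\<close> by simp
    moreover have "x powr q * x powr (\<beta> + 1) = x powr (p * (l + 2) - 1)"
      by (simp add: powr_add[symmetric] q_def)
    ultimately show ?thesis
      by (simp add: L_def mult.assoc)
  qed
  \<comment> \<open>The conditions of the invariant region imposed on the data at time 0. They are
    strict inequalities between continuous functions on the plane, the absolute value securing
    continuity of the power.\<close>
  define U where "U = {z :: real \<times> real. 0 < fst z \<and> fst z < \<epsilon> \<and> snd z < 0 \<and>
    - snd z < K * \<bar>fst z\<bar> powr p}"
  have "open U"
    unfolding U_def using \<open>p > 1\<close>
    by (intro open_Collect_conj open_Collect_less continuous_intros continuous_on_powr') auto
  moreover have "(\<epsilon> / 2, - (K * (\<epsilon> / 2) powr p) / 2) \<in> U"
    using \<open>\<epsilon> > 0\<close> \<open>K > 0\<close> by (auto simp: U_def)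
  then have "U \<noteq> {}"
    by blast
  moreover have "slow \<alpha> \<beta> d l u u'"
    if "(u 0, u' 0) \<in> U" and sol: "solution_half_line \<alpha> \<beta> c d l u u'" for u u'
  proof -
    have "0 < u 0" "u 0 < \<epsilon>" "u' 0 < 0" "- u' 0 < K * u 0 powr p"
      using that(1) by (auto simp: U_def)
    note region = invariant_region[OF \<open>c > 0\<close> \<open>d > 0\<close> \<open>l \<ge> 0\<close> \<open>\<alpha> > 0\<close> \<open>K > 0\<close> K \<open>p > 1\<close> p \<epsilon> sol this]
    show ?thesis
    proof (rule slow_if_power_inequality[OF \<open>d > 0\<close> \<open>\<alpha> > 0\<close> \<open>\<alpha> < \<beta>\<close> \<open>l \<ge> 0\<close> \<open>K > 0\<close> p])
      show "(u has_real_derivative u' t) (at t within {0..})" if "t \<ge> 0" for t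
        using sol that by (auto simp: solution_half_line_def C1_half_line_def)
    qed (use region in \<open>auto intro: less_imp_le\<close>)
  qed
  ultimately show ?thesis
    by (intro exI[of _ U]) auto
qed

end
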